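(* Let $I\subseteq\mathbb{R}$ be an interval, let $\mathcal{F}=(f_x\colon I\to\mathbb{R})_{x\in[0,1]}$ be an admissible family and let $\mathcal{T}$ be a finite subset of $\mathcal{CM}(I)$. Assume that for every $x\in[0,1]$ there exist $l_x,u_x\in\mathcal{T}$ such that $\mathscr{A}^{[l_x]}\le\mathscr{A}^{[f_x]}\le\mathscr{A}^{[u_x]}$ pointwise on $\mathcal{P}(I)$. Then there exists a uniquely determined $\mathbf{A}_{\mathcal{F}}$-invariant mean $K_{\mathcal{F}}\colon\mathcal{P}(I)\to I$ (i.e. there is exactly one $\mathbf{A}_{\mathcal{F}}$-invariant mean).
   Context: Let $I\subseteq\mathbb{R}$ be an interval. $\mathcal{CM}(I)$ is the family of all continuous, strictly monotone functions $I\to\mathbb{R}$. $\mathcal{P}(I)$ denotes the family of all compactly supported probability measures on the Borel $\sigma$-algebra $\mathcal{B}(I)$. For $\mathbb{P}\in\mathcal{P}(I)$ put $\gamma(\mathbb{P}):=[\inf\operatorname{supp}\mathbb{P},\sup\operatorname{supp}\mathbb{P}]$. A (integral) mean on $I$ is a function $M\colon\mathcal{P}(I)\to I$ with $M(\mathbb{P})\in\gamma(\mathbb{P})$ for all $\mathbb{P}\in\mathcal{P}(I)$. For $f\in\mathcal{CM}(I)$, the quasiarithmetic mean $\mathscr{A}^{[f]}\colon\mathcal{P}(I)\to I$ is $\mathscr{A}^{[f]}(\mathbb{P}):=f^{-1}\big(\int f(x)\,d\mathbb{P}(x)\big)$. A family $\mathcal{F}=(f_x)_{x\in[0,1]}$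 of functions $f_x\colon I\to\mathbb{R}$ is admissible if (1) each $f_x$ is continuous and strictly monotone, and (2) the function $I\times[0,1]\ni(t,x)\mapsto f_x(t)$ is measurable with respect to the product $\sigma$-algebra $\mathcal{B}(I)\times\mathcal{L}[0,1]$, where $\mathcal{L}[0,1]$ is the Lebesgue $\sigma$-algebra on $[0,1]$. For an admissible family $\mathcal{F}$ and $\mathbb{P}\in\mathcal{P}(I)$, $\mathbf{A}_{\mathcal{F}}(\mathbb{P})$ is the Borel measure $S\mapsto|\{x\in[0,1]\colon\mathscr{A}^{[f_x]}(\mathbb{P})\in S\}|$, where $|\cdot|$ is Lebesgue measure; it is an element of $\mathcal{P}(I)$, so $\mathbf{A}_{\mathcal{F}}$ is a selfmap of $\mathcal{P}(I)$. A mean $M\colon\mathcal{P}(I)\to I$ is $\mathbf{A}_{\mathcal{F}}$-invariant if $M\circ\mathbf{A}_{\mathcal{F}}=M$. *)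

theory Defs
  imports "HOL-Probability.Probability"
begin

text \<open>Functions on I are total HOL functions of which only the values on I matter.\<close>

definition CM :: "real set \<Rightarrow> (real \<Rightarrow> real) set" where
  "CM I = {f. continuous_on I f \<and> (strict_mono_on I f \<or> strict_antimono_on I f)}"

text \<open>The topological support is relative to the space of the measure, in its subspace topology.\<close>

definition supp :: "real measure \<Rightarrow> real set" where
  "supp P = {x \<in> space P. \<forall>U. open U \<and> x \<in> U \<longrightarrow> emeasure P (U \<inter> space P) > 0}"

text \<open>The support is a subset of I, so that compactness forces it to stay away from the
  endpoints of I that do not belong to I.\<close>

definition compact_probs :: "real set \<Rightarrow> real measure set" where
  "compact_probs I =
     {P. prob_space P \<and> sets P = sets (restrict_space borel I) \<and> compact (supp P)}"

definition supp_hull :: "real measure \<Rightarrow> real set" where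
  "supp_hull P = {Inf (supp P)..Sup (supp P)}"

text \<open>Means are extensional functions on the set of measures (arbitrary but fixed value outside
  it), so that equality of means is equality as functions from that set to I.\<close>

definition means :: "real set \<Rightarrow> (real measure \<Rightarrow> real) set" where
  "means I = {M \<in> compact_probs I \<rightarrow>\<^sub>E I. \<forall>P\<in>compact_probs I. M P \<in> supp_hull P}"

definition quasiarithmetic_mean ::
    "real set \<Rightarrow> (real \<Rightarrow> real) \<Rightarrow> real measure \<Rightarrow> real" where
  "quasiarithmetic_mean I f P = the_inv_into I f (\<integral>t. f t \<partial>P)"

definition admissible_family :: "real set \<Rightarrow> (real \<Rightarrow> real \<Rightarrow> real) \<Rightarrow> bool" where
  "admissible_family I F \<longleftrightarrow>
     (\<forall>x\<in>{0..1}. F x \<in> CM I) \<and>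
     (\<lambda>(t, x). F x t) \<in> borel_measurable (restrict_space borel I \<Otimes>\<^sub>M lebesgue_on {0..1})"

text \<open>The push-forward of Lebesgue measure on the unit interval along the map sending x to the
  quasiarithmetic mean generated by the x-th member of the family.\<close>

definition mean_selfmap ::
    "real set \<Rightarrow> (real \<Rightarrow> real \<Rightarrow> real) \<Rightarrow> real measure \<Rightarrow> real measure" where
  "mean_selfmap I F P =
     distr (lebesgue_on {0..1}) (restrict_space borel I) (\<lambda>x. quasiarithmetic_mean I (F x) P)"

definition invariant_mean ::
    "real set \<Rightarrow> (real \<Rightarrow> real \<Rightarrow> real) \<Rightarrow> (real measure \<Rightarrow> real) \<Rightarrow> bool" where
  "invariant_mean I F M \<longleftrightarrow>
     M \<in> means I \<and> (\<forall>P\<in>compact_probs I. M (mean_selfmap I F P) = M P)"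

end

theory Submission
  imports Defs
begin

text \<open>
  Iterating the selfmap from a measure gives nested hulls, and everything follows once their
  lengths tend to zero: an invariant mean must take its value in all of them. Suppose instead that
  the endpoints converge to limits a < b with midpoint m. The upper endpoint of the next hull is at
  most the value of one of the finitely many means generated by T. That value is at least b
  although the current hull reaches only slightly beyond b, so less than half of the mass can lie
  to the left of m. By symmetry less than half of the mass lies to the right of m, which is absurd.
\<close>

section \<open>Compactly supported measures\<close>

lemma compact_probs_space:
  assumes "P \<in> compact_probs I"
  shows "space P = I"
  using assms sets_eq_imp_space_eq[of P "restrict_space borel I"]
  by (auto simp: compact_probs_def space_restrict_space)

lemma compact_probs_borel_measurable:
  assumes "P \<in> compact_probs I" and "f \<in> borel_measurable (restrict_space borel I)"
  shows "f \<in> borel_measurable P"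
  using assms measurable_cong_sets[of P "restrict_space borel I" borel borel]
  by (auto simp: compact_probs_def)

lemma supp_subset_space: "supp P \<subseteq> space P"
  by (auto simp: supp_def)

text \<open>The complement of the support is a union of possibly uncountably many null open sets.
  Members of a countable basis suffice to form it, so a countable union of null sets
  remains.\<close>

lemma AE_supp:
  assumes P: "P \<in> compact_probs I"
  shows "AE t in P. t \<in> supp P"
proof -
  have sp: "space P = I" and st: "sets P = sets (restrict_space borel I)"
    using P compact_probs_space by (auto simp: compact_probs_def)
  obtain B :: "real set set" where B: "countable B" "topological_basis B"
    using ex_countable_basis by blast
  define N where "N = {U \<in> B. emeasure P (U \<inter> I) = 0}"
  have meas: "U \<inter> I \<in> sets P" if "open U" for U
    using that unfolding st sets_restrict_space by auto
  have "AE t in P. t \<notin> U" if "U \<in> N" for U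
  proof (rule AE_I[where N = "U \<inter> I"])
    show "U \<inter> I \<in> sets P"
      using that B(2) topological_basis_open meas by (auto simp: N_def)
  qed (use that sp in \<open>auto simp: N_def\<close>)
  moreover have "countable N"
    using B(1) by (simp add: N_def)
  ultimately have "AE t in P. \<forall>U\<in>N. t \<notin> U"
    by (simp add: AE_ball_countable)
  then show ?thesis
  proof (rule AE_mp, intro AE_I2 impI)
    fix t assume t: "t \<in> space P" "\<forall>U\<in>N. t \<notin> U"
    show "t \<in> supp P"
    proof (rule ccontr)
      assume "t \<notin> supp P"
      then obtain U where U: "open U" "t \<in> U" "emeasure P (U \<inter> I) = 0"
        using t(1) sp by (auto simp: supp_def)
      obtain V where V: "V \<in> B" "t \<in> V" "V \<subseteq> U"
        using topological_basisE[OF B(2) U(1,2)] by blast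
      have "emeasure P (V \<inter> I) \<le> emeasure P (U \<inter> I)"
        using V U meas by (intro emeasure_mono) auto
      then have "V \<in> N"
        using V U by (simp add: N_def)
      then show False
        using t V by blast
    qed
  qed
qed

lemma supp_nonempty:
  assumes "P \<in> compact_probs I"
  shows "supp P \<noteq> {}"
proof
  assume "supp P = {}"
  then have "AE t in P. False"
    using AE_supp[OF assms] by simp
  moreover have "prob_space P"
    using assms by (simp add: compact_probs_def)
  ultimately show False
    using prob_space.AE_False by blast
qed

text \<open>Compactness puts both extrema into the support itself, hence into \<open>I\<close> even
  when \<open>I\<close> is not closed.\<close>

lemma supp_hull_endpoints:
  assumes P: "P \<in> compact_probs I"
  shows "Inf (supp P) \<in> I" "Sup (supp P) \<in> I" "Inf (supp P) \<le> Sup (supp P)"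
    and "AE t in P. Inf (supp P) \<le> t \<and> t \<le> Sup (supp P)"
proof -
  have c: "compact (supp P)"
    using P by (simp add: compact_probs_def)
  note ne = supp_nonempty[OF P]
  have bd: "bdd_below (supp P)" "bdd_above (supp P)"
    using c by (simp_all add: compact_imp_bounded bounded_imp_bdd_below bounded_imp_bdd_above)
  have sub: "supp P \<subseteq> I"
    using supp_subset_space compact_probs_space[OF P] by blast
  have "Inf (supp P) \<in> supp P" "Sup (supp P) \<in> supp P"
    using c ne bd by (simp_all add: closed_contains_Inf closed_contains_Sup compact_imp_closed)
  then show "Inf (supp P) \<in> I" "Sup (supp P) \<in> I"
    using sub by auto
  show "Inf (supp P) \<le> Sup (supp P)"
    using ne bd by (simp add: cInf_le_cSup)
  show "AE t in P. Inf (supp P) \<le> t \<and> t \<le> Sup (supp P)"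
    using AE_supp[OF P] by eventually_elim (use bd in \<open>auto intro: cInf_lower cSup_upper\<close>)
qed

lemma supp_hull_subset:
  assumes "P \<in> compact_probs I" "is_interval I"
  shows "{Inf (supp P)..Sup (supp P)} \<subseteq> I"
  using mem_is_interval_1_I[OF assms(2) supp_hull_endpoints(1,2)[OF assms(1)]] by auto

text \<open>The complement of \<open>C\<close> is open with null trace on \<open>I\<close>, so it
  misses the support. This turns almost sure bounds into bounds on the hull.\<close>

lemma supp_subset_of_AE:
  assumes "sets P = sets (restrict_space borel I)" "closed C" "AE t in P. t \<in> C"
  shows "supp P \<subseteq> C"
proof
  fix x assume x: "x \<in> supp P"
  have sp: "space P = I"
    using sets_eq_imp_space_eq[OF assms(1)] by (simp add: space_restrict_space)
  have "- C \<inter> space P \<in> sets P"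
    unfolding assms(1) sp sets_restrict_space using assms(2) by auto
  then have "emeasure P (- C \<inter> space P) = 0"
    using assms(3) by (subst AE_iff_measurable[symmetric]) auto
  then show "x \<in> C"
    using x assms(2) by (force simp: supp_def)
qed

text \<open>By definition the support is closed only relative to \<open>I\<close>, so its
  compactness is not automatic. Inside the compact set \<open>C\<close> it is cut out by removing
  null open sets.\<close>

lemma compact_supp_of_AE:
  assumes "sets P = sets (restrict_space borel I)" "compact C" "C \<subseteq> I" "AE t in P. t \<in> C"
  shows "compact (supp P)"
proof -
  have sp: "space P = I"
    using sets_eq_imp_space_eq[OF assms(1)] by (simp add: space_restrict_space)
  have sub: "supp P \<subseteq> C"
    using supp_subset_of_AE assms compact_imp_closed by blast
  let ?W = "\<Union>{U. open U \<and> emeasure P (U \<inter> space P) = 0}"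
  have "supp P = C \<inter> - ?W"
  proof
    show "supp P \<subseteq> C \<inter> - ?W"
      using sub by (force simp: supp_def)
    show "C \<inter> - ?W \<subseteq> supp P"
      using assms(3) sp by (auto simp: supp_def zero_less_iff_neq_zero)
  qed
  moreover have "closed (- ?W)"
    by auto
  ultimately show ?thesis
    using assms(2) compact_Int_closed by simp
qed

section \<open>Quasiarithmetic means\<close>

lemma CM_inj_on:
  assumes "f \<in> CM I"
  shows "inj_on f I"
  using assms unfolding CM_def inj_on_def monotone_on_def
  by (metis (mono_tags, lifting) linorder_neqE less_irrefl mem_Collect_eq)

text \<open>A generator and its negative yield the same mean, so arguments may be carried out for
  increasing functions; \<open>s\<close> is the sign that makes \<open>f\<close> increasing.\<close>

lemma CM_normalise:
  assumes "f \<in> CM I"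
  obtains s :: real where "\<bar>s\<bar> = 1" "strict_mono_on I (\<lambda>t. s * f t)"
proof (cases "strict_mono_on I f")
  case True
  then show ?thesis using that[of 1] by simp
next
  case False
  then have "strict_mono_on I (\<lambda>t. (-1) * f t)"
    using assms by (auto simp: CM_def monotone_on_def)
  then show ?thesis using that[of "-1"] by simp
qed

text \<open>\<open>f\<close> may be unbounded on \<open>I\<close>, but it is bounded on the compact
  hull, which carries all the mass.\<close>

lemma CM_integrable:
  assumes P: "P \<in> compact_probs I" and I: "is_interval I" and f: "f \<in> CM I"
  shows "integrable P f"
proof -
  interpret prob_space P
    using P by (simp add: compact_probs_def)
  let ?J = "{Inf (supp P)..Sup (supp P)}"
  have cont: "continuous_on I f"
    using f by (simp add: CM_def)
  then have "compact (f ` ?J)"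
    using supp_hull_subset[OF P I] by (intro compact_continuous_image continuous_on_subset[OF cont]) auto
  then obtain B where B: "\<And>t. t \<in> ?J \<Longrightarrow> norm (f t) \<le> B"
    by (metis bounded_iff compact_imp_bounded imageI)
  show ?thesis
  proof (rule integrable_const_bound)
    show "AE t in P. norm (f t) \<le> B"
      using supp_hull_endpoints(4)[OF P] by eventually_elim (use B in auto)
    show "f \<in> borel_measurable P"
      using P borel_measurable_continuous_on_restrict[OF cont] by (rule compact_probs_borel_measurable)
  qed
qed

lemma quasiarithmetic_mean_eqI:
  assumes "f \<in> CM I" "y \<in> I" "f y = (\<integral>t. f t \<partial>P)"
  shows "quasiarithmetic_mean I f P = y"
  unfolding quasiarithmetic_mean_def assms(3)[symmetric]
  using CM_inj_on[OF assms(1)] assms(2) by (rule the_inv_into_f_f)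

text \<open>The integral of the increasing function \<open>s * f\<close> lies between its values at
  the endpoints of the hull, so the intermediate value theorem applies. Hence the inverse in
  \<open>quasiarithmetic_mean\<close> is taken at a value that \<open>f\<close> attains.\<close>

lemma integral_in_image_hull:
  assumes P: "P \<in> compact_probs I" and I: "is_interval I" and f: "f \<in> CM I"
  shows "\<exists>y\<in>{Inf (supp P)..Sup (supp P)}. f y = (\<integral>t. f t \<partial>P)"
proof -
  interpret prob_space P
    using P by (simp add: compact_probs_def)
  let ?a = "Inf (supp P)" and ?b = "Sup (supp P)"
  note ends = supp_hull_endpoints[OF P]
  note int = CM_integrable[OF P I f]
  obtain s :: real where s: "\<bar>s\<bar> = 1" "strict_mono_on I (\<lambda>t. s * f t)"
    using CM_normalise[OF f] by blast
  have mono: "s * f x \<le> s * f y" if "x \<in> I" "y \<in> I" "x \<le> y" for x y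
    using strict_mono_on_imp_mono_on[OF s(2)] that by (auto simp: monotone_on_def)
  have AE_I: "AE t in P. t \<in> I"
    using compact_probs_space[OF P] by auto
  have le: "AE t in P. s * f ?a \<le> s * f t \<and> s * f t \<le> s * f ?b"
    using ends(4) AE_I by eventually_elim (use mono ends in auto)
  have "s * f ?a \<le> (\<integral>t. s * f t \<partial>P)"
    using le int by (intro integral_ge_const) auto
  moreover have "(\<integral>t. s * f t \<partial>P) \<le> s * f ?b"
    using le int by (intro integral_le_const) auto
  moreover have "continuous_on {?a..?b} (\<lambda>t. s * f t)"
    by (rule continuous_on_subset[OF _ supp_hull_subset[OF P I]])
      (use f in \<open>simp add: CM_def continuous_on_mult_left\<close>)
  ultimately obtain y where "?a \<le> y" "y \<le> ?b" "s * f y = (\<integral>t. s * f t \<partial>P)"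
    using IVT'[of "\<lambda>t. s * f t" ?a _ ?b] ends(3) by blast
  moreover have "s \<noteq> 0"
    using s(1) by auto
  ultimately show ?thesis
    by auto
qed

lemma
  assumes P: "P \<in> compact_probs I" and I: "is_interval I" and f: "f \<in> CM I"
  shows quasiarithmetic_mean_in_hull:
      "quasiarithmetic_mean I f P \<in> {Inf (supp P)..Sup (supp P)}"
    and apply_quasiarithmetic_mean: "f (quasiarithmetic_mean I f P) = (\<integral>t. f t \<partial>P)"
proof -
  obtain y where y: "y \<in> {Inf (supp P)..Sup (supp P)}" "f y = (\<integral>t. f t \<partial>P)"
    using integral_in_image_hull[OF P I f] by blast
  then have "quasiarithmetic_mean I f P = y"
    using quasiarithmetic_mean_eqI f supp_hull_subset[OF P I] by blast
  then show "quasiarithmetic_mean I f P \<in> {Inf (supp P)..Sup (supp P)}"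
    "f (quasiarithmetic_mean I f P) = (\<integral>t. f t \<partial>P)"
    using y by auto
qed

section \<open>The selfmap\<close>

text \<open>The factor F x q - F x p has the sign of the monotonicity of F x and thus treats increasing
  and decreasing generators at once.\<close>

lemma quasiarithmetic_mean_le_iff:
  assumes P: "P \<in> compact_probs I" and I: "is_interval I" and f: "f \<in> CM I"
    and "p \<in> I" "q \<in> I" "p < q" "y \<in> I"
  shows "quasiarithmetic_mean I f P \<le> y \<longleftrightarrow> ((\<integral>t. f t \<partial>P) - f y) * (f q - f p) \<le> 0"
proof -
  let ?A = "quasiarithmetic_mean I f P"
  have A: "?A \<in> I"
    using quasiarithmetic_mean_in_hull[OF P I f] supp_hull_subset[OF P I] by blast
  obtain s :: real where s: "\<bar>s\<bar> = 1" "strict_mono_on I (\<lambda>t. s * f t)"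
    using CM_normalise[OF f] by blast
  have pos: "0 < s * f q - s * f p"
    using s(2) assms by (auto simp: monotone_on_def)
  have "?A \<le> y \<longleftrightarrow> s * f ?A \<le> s * f y"
    using strict_mono_on_less_eq[OF s(2) A \<open>y \<in> I\<close>] by simp
  also have "\<dots> \<longleftrightarrow> (s * f ?A - s * f y) * (s * f q - s * f p) \<le> 0"
    using pos by (simp add: mult_le_0_iff)
  \<comment> \<open>The unknown sign occurs in both factors and so disappears as a square.\<close>
  also have "(s * f ?A - s * f y) * (s * f q - s * f p) = s\<^sup>2 * ((f ?A - f y) * (f q - f p))"
    by (simp add: algebra_simps power2_eq_square)
  also have "s\<^sup>2 = 1"
    using s(1) by (simp add: abs_square_eq_1)
  finally show ?thesis
    using apply_quasiarithmetic_mean[OF P I f] by simp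
qed

text \<open>The inverse of \<open>F x\<close> varies with \<open>x\<close>, so it is avoided:
  \<open>quasiarithmetic_mean_le_iff\<close> describes sublevel sets by the integral and by point
  evaluations of \<open>F x\<close>, which are measurable in \<open>x\<close>.\<close>

lemma quasiarithmetic_mean_measurable:
  assumes P: "P \<in> compact_probs I" and I: "is_interval I" and F: "admissible_family I F"
  shows "(\<lambda>x. quasiarithmetic_mean I (F x) P) \<in> lebesgue_on {0..1} \<rightarrow>\<^sub>M restrict_space borel I"
proof -
  interpret prob_space P
    using P by (simp add: compact_probs_def)
  let ?L = "lebesgue_on {0..1::real}" and ?a = "Inf (supp P)" and ?b = "Sup (supp P)"
  let ?A = "\<lambda>x. quasiarithmetic_mean I (F x) P"
  note ends = supp_hull_endpoints[OF P]
  have CM: "F x \<in> CM I" if "x \<in> space ?L" for x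
    using F that by (auto simp: admissible_family_def)
  have hull: "?A x \<in> {?a..?b}" if "x \<in> space ?L" for x
    using quasiarithmetic_mean_in_hull[OF P I CM[OF that]] .
  have in_I: "?A x \<in> I" if "x \<in> space ?L" for x
    using hull[OF that] supp_hull_subset[OF P I] by blast
  have joint: "(\<lambda>(t, x). F x t) \<in> borel_measurable (restrict_space borel I \<Otimes>\<^sub>M ?L)"
    using F by (simp add: admissible_family_def)
  have section_meas: "(\<lambda>x. F x t) \<in> borel_measurable ?L" if "t \<in> I" for t
    using measurable_compose[OF measurable_Pair1'[of t "restrict_space borel I" ?L] joint] that
    by (simp add: space_restrict_space)
  have swap: "(\<lambda>(x, t). F x t) \<in> borel_measurable (?L \<Otimes>\<^sub>M restrict_space borel I)"
    using measurable_pair_swap[OF joint] by (simp add: case_prod_beta)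
  have "sets (?L \<Otimes>\<^sub>M P) = sets (?L \<Otimes>\<^sub>M restrict_space borel I)"
    using P by (intro sets_pair_measure_cong) (auto simp: compact_probs_def)
  then have "(\<lambda>(x, t). F x t) \<in> borel_measurable (?L \<Otimes>\<^sub>M P)"
    using swap measurable_cong_sets by blast
  then have int_meas: "(\<lambda>x. \<integral>t. F x t \<partial>P) \<in> borel_measurable ?L"
    by (rule borel_measurable_lebesgue_integral)
  \<comment> \<open>The criterion needs two distinct reference points in \<open>I\<close>. The hull
    endpoints serve unless they coincide, and then the mean is constant in \<open>x\<close>.\<close>
  have "?A \<in> borel_measurable ?L"
  proof (cases "?a < ?b")
    case True
    show ?thesis
      unfolding borel_measurable_iff_le
    proof
      fix y
      \<comment> \<open>A level outside the hull need not belong to \<open>I\<close>, so the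
        criterion is reserved for levels inside it.\<close>
      consider "y < ?a" | "?b < y" | "y \<in> {?a..?b}" by force
      then show "{x \<in> space ?L. ?A x \<le> y} \<in> sets ?L"
      proof cases
        case 1
        then have "{x \<in> space ?L. ?A x \<le> y} = {}"
          using hull by fastforce
        then show ?thesis by (metis sets.empty_sets)
      next
        case 2
        then have "{x \<in> space ?L. ?A x \<le> y} = space ?L"
          using hull by fastforce
        then show ?thesis by (metis sets.top)
      next
        case 3
        then have y: "y \<in> I"
          using supp_hull_subset[OF P I] by blast
        have "{x \<in> space ?L. ?A x \<le> y} =
            {x \<in> space ?L. ((\<integral>t. F x t \<partial>P) - F x y) * (F x ?b - F x ?a) \<le> 0}"
          using quasiarithmetic_mean_le_iff[OF P I CM ends(1,2) True y] by blast
        also have "\<dots> \<in> sets ?L"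
          using int_meas section_meas[OF y] section_meas[OF ends(1)] section_meas[OF ends(2)]
          by (intro borel_measurable_le borel_measurable_times borel_measurable_diff) auto
        finally show ?thesis .
      qed
    qed
  next
    case False
    then have "?A x = ?a" if "x \<in> space ?L" for x
      using hull[OF that] by auto
    then show ?thesis
      using measurable_cong[of ?L ?A "\<lambda>_. ?a" borel] by simp
  qed
  then show ?thesis
    using in_I by (intro measurable_restrict_space2) auto
qed

lemma mean_selfmap_AE:
  assumes P: "P \<in> compact_probs I" and I: "is_interval I" and F: "admissible_family I F"
    and bounds: "\<And>x. x \<in> {0..1} \<Longrightarrow> quasiarithmetic_mean I (F x) P \<in> {c..d}"
  shows "AE t in mean_selfmap I F P. t \<in> {c..d}"
proof -
  have "{t \<in> space (restrict_space borel I). t \<in> {c..d}} = I \<inter> {c..d}"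
    by (auto simp: space_restrict_space)
  moreover have "I \<inter> {c..d} \<in> sets (restrict_space borel I)"
    unfolding sets_restrict_space by (rule imageI) simp
  ultimately have "{t \<in> space (restrict_space borel I). t \<in> {c..d}} \<in> sets (restrict_space borel I)"
    by (simp only:)
  note iff = AE_distr_iff[OF quasiarithmetic_mean_measurable[OF P I F], of "\<lambda>t. t \<in> {c..d}", OF this]
  have "AE x in lebesgue_on {0..1}. quasiarithmetic_mean I (F x) P \<in> {c..d}"
    by (rule AE_I2, rule bounds) simp
  then show ?thesis
    unfolding mean_selfmap_def iff .
qed

text \<open>The image measure is concentrated on the hull of \<open>P\<close>, a compact subset of
  \<open>I\<close>. Hence the selfmap can be iterated.\<close>

lemma mean_selfmap_compact_probs:
  assumes P: "P \<in> compact_probs I" and I: "is_interval I" and F: "admissible_family I F"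
  shows "mean_selfmap I F P \<in> compact_probs I"
proof -
  have "prob_space (lebesgue_on {0..1::real})"
    by (intro prob_spaceI) (simp add: emeasure_restrict_space space_restrict_space)
  then have "prob_space (mean_selfmap I F P)"
    unfolding mean_selfmap_def
    using quasiarithmetic_mean_measurable[OF P I F] by (rule prob_space.prob_space_distr)
  moreover have st: "sets (mean_selfmap I F P) = sets (restrict_space borel I)"
    by (simp add: mean_selfmap_def)
  moreover have "AE t in mean_selfmap I F P. t \<in> {Inf (supp P)..Sup (supp P)}"
    using P I F
  proof (rule mean_selfmap_AE)
    fix x :: real assume "x \<in> {0..1}"
    then have "F x \<in> CM I"
      using F by (auto simp: admissible_family_def)
    then show "quasiarithmetic_mean I (F x) P \<in> {Inf (supp P)..Sup (supp P)}"
      by (rule quasiarithmetic_mean_in_hull[OF P I])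
  qed
  then have "compact (supp (mean_selfmap I F P))"
    using supp_hull_subset[OF P I] st by (intro compact_supp_of_AE[where I = I]) auto
  ultimately show ?thesis
    by (simp add: compact_probs_def)
qed

lemma mean_selfmap_hull_bounds:
  assumes P: "P \<in> compact_probs I" and I: "is_interval I" and F: "admissible_family I F"
    and bounds: "\<And>x. x \<in> {0..1} \<Longrightarrow> quasiarithmetic_mean I (F x) P \<in> {c..d}"
  shows "c \<le> Inf (supp (mean_selfmap I F P))" "Sup (supp (mean_selfmap I F P)) \<le> d"
proof -
  have "supp (mean_selfmap I F P) \<subseteq> {c..d}"
    using mean_selfmap_AE[OF assms]
    by (intro supp_subset_of_AE[where I = I]) (auto simp: mean_selfmap_def)
  moreover have "supp (mean_selfmap I F P) \<noteq> {}"
    using supp_nonempty mean_selfmap_compact_probs[OF P I F] by blast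
  ultimately show "c \<le> Inf (supp (mean_selfmap I F P))" "Sup (supp (mean_selfmap I F P)) \<le> d"
    by (auto intro!: cInf_greatest cSup_least)
qed

section \<open>Shrinking of the hulls\<close>

text \<open>A Markov-type estimate: almost everywhere \<open>g\<close> is at most the step function
  with value \<open>m\<close> on \<open>S\<close> and \<open>e\<close> elsewhere. Integration gives
  \<open>(e - m) * measure M S \<le> e - b\<close>, and the gap makes the right side less than half
  of \<open>e - m\<close>.\<close>

lemma (in prob_space) mass_less_half:
  fixes g :: "'a \<Rightarrow> real"
  assumes int: "integrable M g" and S: "S \<in> sets M"
    and top: "AE t in M. g t \<le> e" and low: "AE t in M. t \<in> S \<longrightarrow> g t \<le> m"
    and large: "b \<le> (\<integral>t. g t \<partial>M)" and gap: "m < b" "2 * \<bar>e - b\<bar> < b - m"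
  shows "measure M S < 1 / 2"
proof -
  have "(\<integral>t. g t \<partial>M) \<le> (\<integral>t. e - (e - m) * indicator S t \<partial>M)"
  proof (rule integral_mono_AE)
    show "AE t in M. g t \<le> e - (e - m) * indicator S t"
      using top low by eventually_elim (auto simp: indicator_def)
    show "integrable M (\<lambda>t. e - (e - m) * indicator S t)"
      using S by (auto simp: emeasure_eq_measure)
  qed (rule int)
  also have "\<dots> = e - (e - m) * measure M S"
    using S by (simp add: prob_space emeasure_eq_measure)
  finally have "(e - m) * measure M S \<le> e - b"
    using large by simp
  also have "\<dots> < (e - m) * (1 / 2)"
    using gap by (simp add: abs_if split: if_splits)
  \<comment> \<open>Cancelling \<open>e - m\<close> needs its positivity: the integral is at least
    \<open>b\<close> and at most \<open>e\<close>, so \<open>m < b \<le> e\<close>.\<close>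
  finally show ?thesis
    using gap large integral_le_const[OF int top] by (simp add: mult_less_cancel_left)
qed

text \<open>\<open>mass_less_half\<close> is applied to the increasing version \<open>g\<close> of
  \<open>f\<close>, then to \<open>- g\<close>. Absolute values make the closeness hypotheses
  independent of the direction of \<open>f\<close>. Later \<open>b\<close> is the limit of the upper
  or of the lower endpoints, and \<open>m\<close> is the midpoint of the two limits.\<close>

lemma mass_outside_midpoint:
  assumes P: "P \<in> compact_probs I" and I: "is_interval I" and f: "f \<in> CM I"
    and "b \<in> I" "m \<in> I"
  shows "b \<le> quasiarithmetic_mean I f P \<Longrightarrow> m < b \<Longrightarrow>
      2 * \<bar>f (Sup (supp P)) - f b\<bar> < \<bar>f b - f m\<bar> \<Longrightarrow>
      measure P {t \<in> space P. t \<le> m} < 1 / 2"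
    and "quasiarithmetic_mean I f P \<le> b \<Longrightarrow> b < m \<Longrightarrow>
      2 * \<bar>f (Inf (supp P)) - f b\<bar> < \<bar>f b - f m\<bar> \<Longrightarrow>
      measure P {t \<in> space P. m \<le> t} < 1 / 2"
proof -
  interpret prob_space P
    using P by (simp add: compact_probs_def)
  note ends = supp_hull_endpoints[OF P]
  have sp: "space P = I"
    by (rule compact_probs_space[OF P])
  let ?A = "quasiarithmetic_mean I f P"
  have A: "?A \<in> I"
    using quasiarithmetic_mean_in_hull[OF P I f] supp_hull_subset[OF P I] by blast
  obtain s :: real where s: "\<bar>s\<bar> = 1" "strict_mono_on I (\<lambda>t. s * f t)"
    using CM_normalise[OF f] by blast
  define g where "g = (\<lambda>t. s * f t)"
  have less: "g x < g y" if "x \<in> I" "y \<in> I" "x < y" for x y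
    using s(2) that by (auto simp: monotone_on_def g_def)
  have le: "g x \<le> g y" if "x \<in> I" "y \<in> I" "x \<le> y" for x y
    using less that by (cases "x = y") (auto intro: less_imp_le)
  have dist: "\<bar>f x - f y\<bar> = \<bar>g x - g y\<bar>" for x y
    using s(1) by (simp add: g_def right_diff_distrib[symmetric] abs_mult)
  have int: "integrable P g"
    using CM_integrable[OF P I f] by (simp add: g_def)
  have gA: "g ?A = (\<integral>t. g t \<partial>P)"
    using apply_quasiarithmetic_mean[OF P I f] by (simp add: g_def)
  have idm: "(\<lambda>t. t) \<in> borel_measurable P"
    by (rule compact_probs_borel_measurable[OF P]) (simp add: measurable_restrict_space1)
  have AE_I: "AE t in P. t \<in> I"
    using sp by auto
  show "measure P {t \<in> space P. t \<le> m} < 1 / 2"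
    if h: "b \<le> ?A" "m < b" "2 * \<bar>f (Sup (supp P)) - f b\<bar> < \<bar>f b - f m\<bar>"
  proof (rule mass_less_half[OF int])
    show "{t \<in> space P. t \<le> m} \<in> sets P"
      using idm by measurable
    show "AE t in P. g t \<le> g (Sup (supp P))"
      using ends(4) AE_I by eventually_elim (use le ends in auto)
    show "AE t in P. t \<in> {t \<in> space P. t \<le> m} \<longrightarrow> g t \<le> g m"
      using le assms sp by auto
    show "g b \<le> (\<integral>t. g t \<partial>P)"
      unfolding gA[symmetric] using le A h assms by auto
    show "g m < g b"
      using less h assms by auto
    then show "2 * \<bar>g (Sup (supp P)) - g b\<bar> < g b - g m"
      using h(3) by (simp add: dist)
  qed
  \<comment> \<open>Negation exchanges the endpoints: \<open>- g\<close> is bounded above by its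
    value at the lower one.\<close>
  show "measure P {t \<in> space P. m \<le> t} < 1 / 2"
    if h: "?A \<le> b" "b < m" "2 * \<bar>f (Inf (supp P)) - f b\<bar> < \<bar>f b - f m\<bar>"
  proof (rule mass_less_half[where g = "\<lambda>t. - g t"])
    show "integrable P (\<lambda>t. - g t)"
      using int by simp
    show "{t \<in> space P. m \<le> t} \<in> sets P"
      using idm by measurable
    show "AE t in P. - g t \<le> - g (Inf (supp P))"
      using ends(4) AE_I by eventually_elim (use le ends in auto)
    show "AE t in P. t \<in> {t \<in> space P. m \<le> t} \<longrightarrow> - g t \<le> - g m"
      using le assms sp by auto
    show "- g b \<le> (\<integral>t. - g t \<partial>P)"
      using le[OF A \<open>b \<in> I\<close> h(1)] gA by simp
    show "- g m < - g b"
      using less h assms by auto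
    then show "2 * \<bar>- g (Inf (supp P)) - - g b\<bar> < - g b - - g m"
      using h(3) by (simp add: dist abs_minus_commute)
  qed
qed

text \<open>The hypotheses on Q say, in terms of the hull of Q, that Q is the image of P.\<close>

lemma hulls_shrink:
  fixes R :: "nat \<Rightarrow> real measure"
  assumes R: "\<And>n. R n \<in> compact_probs I" and I: "is_interval I"
    and T: "finite T" "T \<subseteq> CM I"
    and lower: "\<And>n. \<exists>l\<in>T. quasiarithmetic_mean I l (R n) \<le> Inf (supp (R (Suc n)))"
    and upper: "\<And>n. \<exists>u\<in>T. Sup (supp (R (Suc n))) \<le> quasiarithmetic_mean I u (R n)"
  obtains c where "(\<lambda>n. Inf (supp (R n))) \<longlonglongrightarrow> c" "(\<lambda>n. Sup (supp (R n))) \<longlonglongrightarrow> c"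
    "\<And>n. c \<in> {Inf (supp (R n))..Sup (supp (R n))}"
proof -
  define lo where "lo n = Inf (supp (R n))" for n
  define hi where "hi n = Sup (supp (R n))" for n
  have ends: "lo n \<in> I" "hi n \<in> I" "lo n \<le> hi n" for n
    using supp_hull_endpoints[OF R] by (auto simp: lo_def hi_def)
  have in_hull: "quasiarithmetic_mean I f (R n) \<in> {lo n..hi n}" if "f \<in> T" for f n
    using quasiarithmetic_mean_in_hull[OF R I] that T by (auto simp: lo_def hi_def)
  \<comment> \<open>The next lower endpoint is at least some mean of the current measure, and that
    mean lies in the current hull.\<close>
  have inc: "incseq lo"
  proof (rule incseq_SucI)
    fix n show "lo n \<le> lo (Suc n)"
      using lower[of n] in_hull[of _ n] unfolding lo_def by (meson atLeastAtMost_iff order_trans)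
  qed
  have dec: "decseq hi"
  proof (rule decseq_SucI)
    fix n show "hi (Suc n) \<le> hi n"
      using upper[of n] in_hull[of _ n] unfolding hi_def by (meson atLeastAtMost_iff order_trans)
  qed
  have "lo n \<le> hi 0" "lo 0 \<le> hi n" for n
    using ends(3)[of n] decseqD[OF dec, of 0 n] incseqD[OF inc, of 0 n] by auto
  then obtain a b where a: "lo \<longlonglongrightarrow> a" "\<forall>n. lo n \<le> a" and b: "hi \<longlonglongrightarrow> b" "\<forall>n. b \<le> hi n"
    using incseq_convergent[OF inc] decseq_convergent[OF dec] by metis
  have ab: "a \<le> b"
    using a(1) b(1) ends(3) by (intro LIMSEQ_le) auto
  \<comment> \<open>The limits cannot escape to an endpoint missing from \<open>I\<close>, being
    trapped in the first hull.\<close>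
  have sub: "{a..b} \<subseteq> I"
  proof
    fix x assume "x \<in> {a..b}"
    then have "lo 0 \<le> x" "x \<le> hi 0"
      using a(2) b(2) by (auto intro: order_trans)
    then show "x \<in> I"
      by (rule mem_is_interval_1_I[OF I ends(1,2)])
  qed
  have "a = b"
  proof (rule ccontr)
    assume "a \<noteq> b"
    define m where "m = (a + b) / 2"
    have m: "a < m" "m < b"
      using ab \<open>a \<noteq> b\<close> by (auto simp: m_def)
    have mem: "a \<in> I" "b \<in> I" "m \<in> I"
      using sub ab m by auto
    \<comment> \<open>Finiteness of \<open>T\<close> lets one index serve all generators, which
      matters because the dominating \<open>l\<close> and \<open>u\<close> are chosen only after
      \<open>n\<close>. Injectivity keeps \<open>f m\<close> away from \<open>f a\<close> and
      \<open>f b\<close>.\<close>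
    have "eventually (\<lambda>n. \<forall>f\<in>T. 2 * \<bar>f (hi n) - f b\<bar> < \<bar>f b - f m\<bar> \<and>
        2 * \<bar>f (lo n) - f a\<bar> < \<bar>f a - f m\<bar>) sequentially"
    proof (intro eventually_ball_finite ballI T(1) eventually_conj)
      fix f assume "f \<in> T"
      then have f: "continuous_on I f" "inj_on f I"
        using T(2) CM_inj_on by (auto simp: CM_def)
      have close: "eventually (\<lambda>n. 2 * \<bar>f (h n) - f z\<bar> < \<bar>f z - f m\<bar>) sequentially"
        if "h \<longlonglongrightarrow> z" "z \<in> I" "z \<noteq> m" "\<And>n. h n \<in> I" for h :: "nat \<Rightarrow> real" and z
      proof -
        have "(\<lambda>n. f (h n)) \<longlonglongrightarrow> f z"
          using that by (intro continuous_on_tendsto_compose[OF f(1)]) auto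
        moreover have "0 < \<bar>f z - f m\<bar> / 2"
          using f(2) that mem by (auto simp: inj_on_def)
        ultimately have "eventually (\<lambda>n. dist (f (h n)) (f z) < \<bar>f z - f m\<bar> / 2) sequentially"
          by (rule tendstoD)
        then show ?thesis
          by eventually_elim (simp add: dist_real_def)
      qed
      show "eventually (\<lambda>n. 2 * \<bar>f (hi n) - f b\<bar> < \<bar>f b - f m\<bar>) sequentially"
        using close[OF b(1)] mem m ends by auto
      show "eventually (\<lambda>n. 2 * \<bar>f (lo n) - f a\<bar> < \<bar>f a - f m\<bar>) sequentially"
        using close[OF a(1)] mem m ends by auto
    qed
    then obtain n where n: "\<And>f. f \<in> T \<Longrightarrow> 2 * \<bar>f (hi n) - f b\<bar> < \<bar>f b - f m\<bar>"
        "\<And>f. f \<in> T \<Longrightarrow> 2 * \<bar>f (lo n) - f a\<bar> < \<bar>f a - f m\<bar>"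
      using eventually_happens by force
    obtain l u where lu: "l \<in> T" "quasiarithmetic_mean I l (R n) \<le> lo (Suc n)"
        "u \<in> T" "hi (Suc n) \<le> quasiarithmetic_mean I u (R n)"
      using lower[of n] upper[of n] by (auto simp: lo_def hi_def)
    interpret prob_space "R n"
      using R by (simp add: compact_probs_def)
    let ?S = "{t \<in> space (R n). t \<le> m}" and ?S' = "{t \<in> space (R n). m \<le> t}"
    have idm: "(\<lambda>t. t) \<in> borel_measurable (R n)"
      by (rule compact_probs_borel_measurable[OF R]) (simp add: measurable_restrict_space1)
    \<comment> \<open>The shift of index is the point: \<open>b \<le> hi (Suc n)\<close>, which in
      turn is at most the mean of \<open>R n\<close> generated by \<open>u\<close>.\<close>
    have "measure (R n) ?S < 1 / 2"
      using n(1)[OF lu(3)] lu T mem m b(2)[rule_format, of "Suc n"]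
      by (intro mass_outside_midpoint(1)[OF R I, of u b]) (auto simp: hi_def)
    moreover have "measure (R n) ?S' < 1 / 2"
      using n(2)[OF lu(1)] lu T mem m a(2)[rule_format, of "Suc n"]
      by (intro mass_outside_midpoint(2)[OF R I, of l a]) (auto simp: lo_def)
    \<comment> \<open>The two half-lines cover the space, so the total mass would be less than
      one.\<close>
    moreover have "measure (R n) (?S \<union> ?S') \<le> measure (R n) ?S + measure (R n) ?S'"
      by (intro measure_Un_le) (use idm in measurable)
    moreover have "?S \<union> ?S' = space (R n)"
      by auto
    ultimately show False
      by (simp add: prob_space)
  qed
  then show ?thesis
    using that[of a] a b by (simp add: lo_def[symmetric] hi_def[symmetric])
qed

section \<open>The invariant mean\<close>

text \<open>The dominating generators vary with \<open>x\<close>, but only finitely many are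
  available: the least and the greatest mean over \<open>T\<close> at this \<open>P\<close> bound
  the whole family at once. The extremal generators may depend on \<open>P\<close>.\<close>

lemma mean_selfmap_extremal_means:
  assumes P: "P \<in> compact_probs I" and I: "is_interval I" and F: "admissible_family I F"
    and T: "finite T"
    and dom: "\<forall>x\<in>{0..1}. \<exists>l\<in>T. \<exists>u\<in>T. \<forall>P\<in>compact_probs I.
           quasiarithmetic_mean I l P \<le> quasiarithmetic_mean I (F x) P \<and>
           quasiarithmetic_mean I (F x) P \<le> quasiarithmetic_mean I u P"
  shows "\<exists>l\<in>T. quasiarithmetic_mean I l P \<le> Inf (supp (mean_selfmap I F P))"
    and "\<exists>u\<in>T. Sup (supp (mean_selfmap I F P)) \<le> quasiarithmetic_mean I u P"
proof -
  let ?V = "(\<lambda>f. quasiarithmetic_mean I f P) ` T"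
  have fin: "finite ?V" and ne: "?V \<noteq> {}"
    using T dom by fastforce+
  have bounds: "quasiarithmetic_mean I (F x) P \<in> {Min ?V..Max ?V}" if x: "x \<in> {0..1}" for x
  proof -
    obtain l u where lu: "l \<in> T" "u \<in> T"
      "quasiarithmetic_mean I l P \<le> quasiarithmetic_mean I (F x) P"
      "quasiarithmetic_mean I (F x) P \<le> quasiarithmetic_mean I u P"
      using dom x P by blast
    then show ?thesis
      using fin by (auto intro: Min.coboundedI[THEN order_trans] order_trans[OF _ Max.coboundedI])
  qed
  show "\<exists>l\<in>T. quasiarithmetic_mean I l P \<le> Inf (supp (mean_selfmap I F P))"
    using mean_selfmap_hull_bounds(1)[OF P I F bounds] Min_in[OF fin ne] by force
  show "\<exists>u\<in>T. Sup (supp (mean_selfmap I F P)) \<le> quasiarithmetic_mean I u P"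
    using mean_selfmap_hull_bounds(2)[OF P I F bounds] Max_in[OF fin ne] by force
qed

theorem theorem3:
  fixes I :: "real set"
    and F :: "real \<Rightarrow> real \<Rightarrow> real"
    and T :: "(real \<Rightarrow> real) set"
  assumes "is_interval I"
    and "admissible_family I F"
    and "finite T"
    and "T \<subseteq> CM I"
    and "\<forall>x\<in>{0..1}. \<exists>l\<in>T. \<exists>u\<in>T. \<forall>P\<in>compact_probs I.
           quasiarithmetic_mean I l P \<le> quasiarithmetic_mean I (F x) P \<and>
           quasiarithmetic_mean I (F x) P \<le> quasiarithmetic_mean I u P"
  shows "\<exists>!K. invariant_mean I F K"
proof -
  define R where "R P n = (mean_selfmap I F ^^ n) P" for P n
  have R_CP: "R P n \<in> compact_probs I" if "P \<in> compact_probs I" for P n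
    using that mean_selfmap_compact_probs[OF _ assms(1,2)] by (induction n) (auto simp: R_def)
  have "\<exists>c. (\<lambda>n. Inf (supp (R P n))) \<longlonglongrightarrow> c \<and> (\<lambda>n. Sup (supp (R P n))) \<longlonglongrightarrow> c \<and>
      (\<forall>n. c \<in> {Inf (supp (R P n))..Sup (supp (R P n))})" if P: "P \<in> compact_probs I" for P
  proof -
    have Suc: "R P (Suc n) = mean_selfmap I F (R P n)" for n
      by (simp add: R_def)
    show ?thesis
      using hulls_shrink[of "R P", OF R_CP[OF P] assms(1,3,4)]
        mean_selfmap_extremal_means[OF R_CP[OF P] assms(1,2,3,5)]
      unfolding Suc by metis
  qed
  then obtain c where c: "\<And>P. P \<in> compact_probs I \<Longrightarrow> (\<lambda>n. Inf (supp (R P n))) \<longlonglongrightarrow> c P"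
      "\<And>P. P \<in> compact_probs I \<Longrightarrow> (\<lambda>n. Sup (supp (R P n))) \<longlonglongrightarrow> c P"
      "\<And>P n. P \<in> compact_probs I \<Longrightarrow> c P \<in> {Inf (supp (R P n))..Sup (supp (R P n))}"
    by metis
  \<comment> \<open>Restriction makes the limit extensional, as membership in \<open>means\<close>
    demands.\<close>
  define K where "K = restrict c (compact_probs I)"
  show ?thesis
  proof (rule ex1I)
    \<comment> \<open>The limit lies in every hull of the orbit, and index 0 gives the hull of
      \<open>P\<close> itself.\<close>
    have hull: "c P \<in> {Inf (supp P)..Sup (supp P)}" if "P \<in> compact_probs I" for P
      using c(3)[OF that, of 0] by (simp add: R_def)
    moreover have "c P \<in> I" if "P \<in> compact_probs I" for P
      using hull[OF that] supp_hull_subset[OF that assms(1)] by blast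
    ultimately have "K \<in> means I"
      by (auto simp: means_def K_def supp_hull_def)
    moreover have "K (mean_selfmap I F P) = K P" if P: "P \<in> compact_probs I" for P
    proof -
      have P': "mean_selfmap I F P \<in> compact_probs I"
        using mean_selfmap_compact_probs[OF P assms(1,2)] .
      \<comment> \<open>The orbit of the image is the orbit of \<open>P\<close> shifted by one, so
        both have the same limit.\<close>
      have "R (mean_selfmap I F P) n = R P (Suc n)" for n
        by (simp add: R_def funpow_swap1)
      then have "(\<lambda>n. Inf (supp (R (mean_selfmap I F P) n))) \<longlonglongrightarrow> c P"
        using LIMSEQ_Suc[OF c(1)[OF P]] by simp
      then show ?thesis
        using LIMSEQ_unique c(1)[OF P'] P P' by (auto simp: K_def)
    qed
    ultimately show "invariant_mean I F K"
      by (simp add: invariant_mean_def)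
  next
    fix M assume M: "invariant_mean I F M"
    show "M = K"
    proof
      fix P show "M P = K P"
      proof (cases "P \<in> compact_probs I")
        case True
        \<comment> \<open>Invariance keeps \<open>M\<close> constant along the orbit, so
          \<open>M P\<close> lies in every hull and is squeezed to the common limit.\<close>
        have "M (R P n) = M P" for n
          using M R_CP[OF True] by (induction n) (auto simp: R_def invariant_mean_def)
        then have "M P \<in> {Inf (supp (R P n))..Sup (supp (R P n))}" for n
          using M R_CP[OF True, of n] by (auto simp: invariant_mean_def means_def supp_hull_def)
        then have "c P \<le> M P" "M P \<le> c P"
          using LIMSEQ_le_const2[OF c(1)[OF True]] LIMSEQ_le_const[OF c(2)[OF True]] by auto
        then show ?thesis
          using True by (simp add: K_def)
      next
        case False
        then show ?thesis
          using M by (auto simp: K_def invariant_mean_def means_def PiE_def extensional_def)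
      qed
    qed
  qed
qed

end
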